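(* Let $n,m,q\in\mathbb{N}$ with $m\le n+1$ and $m\le q\le 2n-2$, let $\gamma=(\gamma_1,\ldots,\gamma_{m-1})\in\mathbb{R}^{m-1}$, and let $\min \mathrm{P}_{nmq}$ be the optimal value of $$\mathrm{P}_{nmq}:\quad \min\ \sum_{i=1}^n x_i^q\quad\text{s.t. } x\in\mathbb{R}^n,\ \sum_{i=1}^n x_i^j=\gamma_j,\quad j=1,\ldots,m-1.$$ Then the following lower bounds hold. (a) $\min\mathrm{P}_{nmq}\ge \mathrm{L}_{nmq}$, where $$\mathrm{L}_{nmq}=\min_s\{\,s_q\ :\ H_n(s)\succeq0,\ s_0=n,\ s_j=\gamma_j,\ j=1,\ldots,m-1\}.$$ (b) If $q=m=2r$ for some $r$, set $\gamma_0=n$ and write $$H_{r+1}(s)=\begin{pmatrix} H_r(\gamma) & u_r(\gamma) \\ {u_r(\gamma)}^T & s_{2r} \end{pmatrix},\qquad u_r(\gamma)^T=(\gamma_r,\ldots,\gamma_{2r-1}).$$ Then, if $H_r(\gamma)$ is invertible, $\min\mathrm{P}_{nmq}\ge u_r(\gamma)^T H_r(\gamma)^{-1}u_r(\gamma)$.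
   Context: For a real sequence $s=(s_0,s_1,s_2,\ldots)$ and $N\ge1$, $H_N(s)=(s_{i+j-2})_{1\le i,j\le N}$ is the Hankel matrix; $H_r(\gamma)$ is the same with entries $\gamma_{i+j-2}$ and $\gamma_0=n$. In $\mathrm{L}_{nmq}$ the variables are $s=(s_0,\ldots,s_{2n-2})$. $A\succeq0$ means $A$ is positive semidefinite. Optimal values are understood as infima in $[-\infty,+\infty]$ (with $+\infty$ for infeasible problems). *)

theory Defs
  imports "Jordan_Normal_Form.Gauss_Jordan_Elimination" "HOL-Library.Extended_Real"
begin

text \<open>Matrix and vector indices start at 0, so the entry \<open>s\<^bsub>i+j-2\<^esub>\<close> of the 1-based
  convention becomes \<open>s (i + j)\<close>.\<close>

definition hankel :: "nat \<Rightarrow> (nat \<Rightarrow> real) \<Rightarrow> real mat" where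
  "hankel N s = mat N N (\<lambda>(i, j). s (i + j))"

definition psd_mat :: "real mat \<Rightarrow> bool" where
  "psd_mat A \<longleftrightarrow> square_mat A \<and> transpose_mat A = A \<and>
     (\<forall>v \<in> carrier_vec (dim_row A). 0 \<le> v \<bullet> (A *\<^sub>v v))"

text \<open>The data \<open>\<gamma>\<^sub>1, \<dots>, \<gamma>\<^bsub>m-1\<^esub>\<close> are given by a function on the natural numbers that is only
  evaluated at \<open>1, \<dots>, m - 1\<close>. Optimal values are infima in the extended reals, where the
  infimum of the empty set is \<open>\<infinity>\<close>.\<close>

definition P_feasible :: "nat \<Rightarrow> nat \<Rightarrow> (nat \<Rightarrow> real) \<Rightarrow> real vec set" where
  "P_feasible n m \<gamma> =
     {x \<in> carrier_vec n. \<forall>j \<in> {1..m - 1}. (\<Sum>i<n. (x $ i) ^ j) = \<gamma> j}"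

definition P_value :: "nat \<Rightarrow> nat \<Rightarrow> nat \<Rightarrow> (nat \<Rightarrow> real) \<Rightarrow> ereal" where
  "P_value n m q \<gamma> = (INF x \<in> P_feasible n m \<gamma>. ereal (\<Sum>i<n. (x $ i) ^ q))"

text \<open>The variables are \<open>s = (s\<^sub>0, \<dots>, s\<^bsub>2n-2\<^esub>)\<close>, that is, \<open>2n - 1\<close> of them.\<close>

definition L_feasible :: "nat \<Rightarrow> nat \<Rightarrow> (nat \<Rightarrow> real) \<Rightarrow> real vec set" where
  "L_feasible n m \<gamma> =
     {s \<in> carrier_vec (2 * n - 1). psd_mat (hankel n (\<lambda>k. s $ k)) \<and> s $ 0 = real n \<and>
        (\<forall>j \<in> {1..m - 1}. s $ j = \<gamma> j)}"

definition L_value :: "nat \<Rightarrow> nat \<Rightarrow> nat \<Rightarrow> (nat \<Rightarrow> real) \<Rightarrow> ereal" where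
  "L_value n m q \<gamma> = (INF s \<in> L_feasible n m \<gamma>. ereal (s $ q))"

definition u_vec :: "nat \<Rightarrow> (nat \<Rightarrow> real) \<Rightarrow> real vec" where
  "u_vec r \<gamma> = vec r (\<lambda>i. \<gamma> (r + i))"

lemma hankel_Suc_block:
  assumes "\<And>j. j < 2 * r \<Longrightarrow> s j = \<gamma> j"
  shows "hankel (Suc r) s =
    four_block_mat (hankel r \<gamma>) (mat_of_cols r [u_vec r \<gamma>])
      (mat_of_rows r [u_vec r \<gamma>]) (mat 1 1 (\<lambda>_. s (2 * r)))"
  by (rule eq_matI)
    (auto simp: hankel_def u_vec_def mat_of_cols_def mat_of_rows_def assms less_Suc_eq
      add.commute mult_2)

end

theory Submission
  imports Defs
begin

text \<open>The power sums \<open>p\<^sub>k = \<Sum>\<^sub>l x\<^sub>l\<^sup>k\<close> of a point \<open>x\<close> form a moment sequence: the quadratic form of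
  their Hankel matrix at \<open>v\<close> is the sum over the points \<open>x\<^sub>l\<close> of the squared values of the
  polynomial with coefficients \<open>v\<close>, so they are feasible for the relaxation. For the second bound take
  \<open>w\<close> with \<open>H w = u\<close>, the coefficients of the least-squares approximation of the monomial of degree \<open>r\<close> by
  polynomials of smaller degree on the points \<open>x\<^sub>l\<close>; the residual sum of squares equals
  \<open>p\<^bsub>2r\<^esub> - u \<bullet> w\<close> and is nonnegative.\<close>

lemma hankel_carrier [simp]: "hankel N s \<in> carrier_mat N N"
  by (simp add: hankel_def)

lemma transpose_hankel: "transpose_mat (hankel N s) = hankel N s"
  by (rule eq_matI) (auto simp: hankel_def add.commute)

text \<open>The matrix reads \<open>s\<close> only up to index 2N - 2, hence the bound on
  \<open>k\<close>. It allows \<open>s\<close> to be a finite vector or data known only in low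
  degrees.\<close>

lemma hankel_quadratic_form:
  assumes "v \<in> carrier_vec N"
    and "\<And>k. k + 1 < 2 * N \<Longrightarrow> s k = (\<Sum>l<n. x l ^ k)"
  shows "v \<bullet> (hankel N s *\<^sub>v v) = (\<Sum>l<n. (\<Sum>i<N. v $ i * x l ^ i)\<^sup>2)"
proof -
  have "v \<bullet> (hankel N s *\<^sub>v v) = (\<Sum>i<N. \<Sum>j<N. v $ i * (s (i + j) * v $ j))"
    using assms(1)
    by (auto simp: scalar_prod_def hankel_def sum_distrib_left atLeast0LessThan intro!: sum.cong)
  also have "\<dots> = (\<Sum>i<N. \<Sum>j<N. \<Sum>l<n. (v $ i * x l ^ i) * (v $ j * x l ^ j))"
    by (intro sum.cong refl)
      (simp add: assms(2) sum_distrib_left sum_distrib_right power_add mult_ac)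
  also have "\<dots> = (\<Sum>i<N. \<Sum>l<n. \<Sum>j<N. (v $ i * x l ^ i) * (v $ j * x l ^ j))"
    by (intro sum.cong refl sum.swap)
  also have "\<dots> = (\<Sum>l<n. \<Sum>i<N. \<Sum>j<N. (v $ i * x l ^ i) * (v $ j * x l ^ j))"
    by (rule sum.swap)
  also have "\<dots> = (\<Sum>l<n. (\<Sum>i<N. v $ i * x l ^ i)\<^sup>2)"
    by (simp add: power2_eq_square sum_product)
  finally show ?thesis .
qed

lemma psd_hankel_power_sums:
  assumes "\<And>k. k + 1 < 2 * N \<Longrightarrow> s k = (\<Sum>l<n. x l ^ k)"
  shows "psd_mat (hankel N s)"
  unfolding psd_mat_def
proof (intro conjI ballI)
  show "square_mat (hankel N s)"
    by (simp add: hankel_def)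
  show "transpose_mat (hankel N s) = hankel N s"
    by (rule transpose_hankel)
  fix v :: "real vec" assume "v \<in> carrier_vec (dim_row (hankel N s))"
  then have "v \<in> carrier_vec N"
    by (simp add: hankel_def)
  then show "0 \<le> v \<bullet> (hankel N s *\<^sub>v v)"
    by (simp only: hankel_quadratic_form[OF _ assms] sum_nonneg zero_le_power2)
qed

text \<open>Links \<open>invertible_mat\<close>, which asserts that some two-sided inverse exists,
  to the option-valued \<open>mat_inverse\<close>, so that \<open>the\<close> is applied to an
  actual inverse.\<close>

lemma mat_inverse_mult_vec:
  fixes A :: "'a::field mat"
  assumes A: "A \<in> carrier_mat N N" and inv: "invertible_mat A" and u: "u \<in> carrier_vec N"
  shows "the (mat_inverse A) *\<^sub>v u \<in> carrier_vec N" "A *\<^sub>v (the (mat_inverse A) *\<^sub>v u) = u"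
proof -
  obtain B where AB: "A * B = 1\<^sub>m N" and BA: "B * A = 1\<^sub>m (dim_row B)"
    using inv A unfolding invertible_mat_def inverts_mat_def by auto
  \<comment> \<open>\<open>inverts_mat\<close> does not fix the shape of \<open>B\<close>; comparing
    column counts in the two identities does.\<close>
  have "dim_col B = N" "dim_row B = N"
    using arg_cong[OF AB, of dim_col] arg_cong[OF BA, of dim_col] A by auto
  then have B: "B \<in> carrier_mat N N"
    by auto
  \<comment> \<open>\<open>mat_inverse\<close> yields \<open>None\<close> only for non-units of the
    matrix ring; the last argument of \<open>ring_mat\<close> is an arbitrary tag.\<close>
  have "A \<in> Units (ring_mat TYPE('a) N undefined)"
    using A B AB BA by (auto simp: Units_def ring_mat_def intro!: bexI[of _ B])
  then obtain C where C: "mat_inverse A = Some C"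
    using mat_inverse(1)[OF A] by fastforce
  from mat_inverse(2)[OF A C]
  have "A * C = 1\<^sub>m N" "C \<in> carrier_mat N N"
    by auto
  with A u C show "the (mat_inverse A) *\<^sub>v u \<in> carrier_vec N"
    "A *\<^sub>v (the (mat_inverse A) *\<^sub>v u) = u"
    by (simp_all flip: assoc_mult_mat_vec)
qed

text \<open>The equation for \<open>w\<close> is the system of normal equations for fitting the r-th
  powers by lower ones.\<close>

lemma power_sum_lower_bound:
  fixes x :: "nat \<Rightarrow> real"
  assumes s: "\<And>k. k < 2 * r \<Longrightarrow> s k = (\<Sum>l<n. x l ^ k)"
    and w: "w \<in> carrier_vec r" and Hw: "hankel r s *\<^sub>v w = u_vec r s"
  shows "u_vec r s \<bullet> w \<le> (\<Sum>l<n. x l ^ (2 * r))"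
proof -
  define f where "f l = (\<Sum>i<r. w $ i * x l ^ i)" for l
  have uw: "u_vec r s \<bullet> w = (\<Sum>l<n. x l ^ r * f l)"
  proof -
    have "u_vec r s \<bullet> w = (\<Sum>i<r. \<Sum>l<n. x l ^ r * (w $ i * x l ^ i))"
      using w by (auto simp: scalar_prod_def u_vec_def s atLeast0LessThan sum_distrib_left
          sum_distrib_right power_add mult_ac intro!: sum.cong)
    also have "\<dots> = (\<Sum>l<n. x l ^ r * f l)"
      unfolding f_def sum_distrib_left by (rule sum.swap)
    finally show ?thesis .
  qed
  \<comment> \<open>Pairing the normal equations with \<open>w\<close> shows that the fit
    \<open>f\<close> is orthogonal to its residual.\<close>
  have "w \<bullet> u_vec r s = (\<Sum>l<n. (f l)\<^sup>2)"
    using hankel_quadratic_form[OF w, where s = s and n = n and x = x] s by (simp add: Hw f_def)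
  moreover have "w \<bullet> u_vec r s = u_vec r s \<bullet> w"
    by (rule comm_scalar_prod[OF w]) (simp add: u_vec_def)
  ultimately have ff: "(\<Sum>l<n. (f l)\<^sup>2) = u_vec r s \<bullet> w"
    by simp
  have "0 \<le> (\<Sum>l<n. (x l ^ r - f l)\<^sup>2)"
    by (simp add: sum_nonneg)
  also have "\<dots> = (\<Sum>l<n. x l ^ (2 * r)) - 2 * (\<Sum>l<n. x l ^ r * f l) + (\<Sum>l<n. (f l)\<^sup>2)"
    by (simp add: power2_diff sum.distrib sum_subtractf sum_distrib_left mult.assoc
        flip: power_mult mult.commute[of r 2])
  \<comment> \<open>The cross term gives -2 and the square term +1 times
    \<open>u_vec r s \<bullet> w\<close>.\<close>
  finally show ?thesis
    using uw ff by simp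
qed

theorem theorem6p6:
  fixes n m q :: nat and \<gamma> :: "nat \<Rightarrow> real"
  assumes "1 \<le> n" and "1 \<le> m" and "m \<le> n + 1" and "m \<le> q" and "q \<le> 2 * n - 2"
  shows "P_value n m q \<gamma> \<ge> L_value n m q \<gamma> \<and>
    (\<forall>r. q = m \<and> m = 2 * r \<longrightarrow>
      (let \<gamma>' = \<gamma>(0 := real n); H = hankel r \<gamma>'; u = u_vec r \<gamma>' in
        invertible_mat H \<longrightarrow>
          P_value n m q \<gamma> \<ge> ereal (u \<bullet> (the (mat_inverse H) *\<^sub>v u))))"
proof (intro conjI allI impI)
  show "L_value n m q \<gamma> \<le> P_value n m q \<gamma>"
    unfolding P_value_def
  proof (rule INF_greatest)
    fix x assume x: "x \<in> P_feasible n m \<gamma>"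
    define s where "s = vec (2 * n - 1) (\<lambda>k. \<Sum>i<n. (x $ i) ^ k)"
    have "psd_mat (hankel n (\<lambda>k. s $ k))"
      by (rule psd_hankel_power_sums[where x = "\<lambda>i. x $ i"]) (simp add: s_def)
    moreover have "s $ j = \<gamma> j" if "j \<in> {1..m - 1}" for j
    proof -
      \<comment> \<open>From j < m \<le> q \<le> 2n - 2, so \<open>j\<close> is a valid index of
        \<open>s\<close>.\<close>
      have "j < 2 * n - 1"
        using that assms by auto
      with that x show ?thesis
        by (simp add: s_def P_feasible_def)
    qed
    ultimately have "s \<in> L_feasible n m \<gamma>"
      using assms by (simp add: L_feasible_def s_def)
    then have "L_value n m q \<gamma> \<le> ereal (s $ q)"
      unfolding L_value_def by (rule INF_lower)
    also have "s $ q = (\<Sum>i<n. (x $ i) ^ q)"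
      using assms by (simp add: s_def)
    finally show "L_value n m q \<gamma> \<le> ereal (\<Sum>i<n. (x $ i) ^ q)" .
  qed
next
  fix r assume qm: "q = m \<and> m = 2 * r"
  define \<gamma>' where "\<gamma>' = \<gamma>(0 := real n)"
  define u where "u = u_vec r \<gamma>'"
  have "ereal (u \<bullet> (the (mat_inverse (hankel r \<gamma>')) *\<^sub>v u)) \<le> P_value n m q \<gamma>"
    if inv: "invertible_mat (hankel r \<gamma>')"
    unfolding P_value_def
  proof (rule INF_greatest)
    fix x assume x: "x \<in> P_feasible n m \<gamma>"
    \<comment> \<open>For k = 0 the power sum is n, as 0^0 = 1; the other degrees are exactly the
      constraints, since m = 2r.\<close>
    have \<gamma>': "\<gamma>' k = (\<Sum>l<n. (x $ l) ^ k)" if "k < 2 * r" for k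
      using that x qm by (cases "k = 0") (auto simp: \<gamma>'_def P_feasible_def)
    have "u \<in> carrier_vec r"
      by (simp add: u_def u_vec_def)
    note w = mat_inverse_mult_vec[OF hankel_carrier inv this]
    show "ereal (u \<bullet> (the (mat_inverse (hankel r \<gamma>')) *\<^sub>v u)) \<le> ereal (\<Sum>i<n. (x $ i) ^ q)"
      using power_sum_lower_bound[where x = "\<lambda>l. x $ l", OF \<gamma>' w[unfolded u_def]] qm
      by (simp add: u_def)
  qed
  then show "let \<gamma>' = \<gamma>(0 := real n); H = hankel r \<gamma>'; u = u_vec r \<gamma>' in
      invertible_mat H \<longrightarrow> P_value n m q \<gamma> \<ge> ereal (u \<bullet> (the (mat_inverse H) *\<^sub>v u))"
    by (simp add: Let_def u_def \<gamma>'_def)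
qed

end
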